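(* Let $\mu>0$ and $\epsilon>0$. Let $F(x)=\Pr\{\zeta\le x\}$ be the distribution function of a nonnegative random variable $\zeta$ with expectation $1/\mu$, and suppose $$\sup_{x,y\ge 0}|F_y(x)-F(x)|<\epsilon,\qquad F_y(x)=\Pr\{\zeta\le x+y\mid\zeta>y\}.$$ Let $\chi$ be a random variable with distribution function $B(x)=\frac12F(x)+\frac12(1-\mathrm{e}^{-\mu x})$, $x\ge 0$, with $B(0)=0$, and let $B_y(x)=\Pr\{\chi\le x+y\mid\chi>y\}$. Then $$\sup_{x\ge 0,\,y\ge 0}|B_y(x)-B(x)|<2\epsilon .$$
   Context: The conditional distribution $F_y$ is considered for those $y\ge 0$ with $\Pr\{\zeta>y\}>0$. *)

theory Defs
  imports "HOL-Probability.Probability"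
begin

text \<open>
  The distribution function of the residual life of \<open>X\<close> at age \<open>y\<close>.  The value is
  meaningful only if \<open>X > y\<close> has positive probability: \<^const>\<open>cond_prob\<close> divides by
  that probability, hence returns 0 otherwise.
\<close>
definition residual_cdf :: "'a measure \<Rightarrow> ('a \<Rightarrow> real) \<Rightarrow> real \<Rightarrow> real \<Rightarrow> real" where
  "residual_cdf M X y x = \<P>(\<omega> in M. X \<omega> \<le> x + y \<bar> X \<omega> > y)"

end

theory Submission
  imports Defs
begin

text \<open>
  Write \<open>G\<close> for the tail \<open>1 - F\<close> of \<open>\<zeta>\<close> and \<open>s\<close> for the supremum in the hypothesis. In terms
  of the tail, that hypothesis says that \<open>G\<close> is almost multiplicative:
  \<open>\<bar>G (x + y) - G x * G y\<bar> \<le> s * G y\<close>. The error is proportional to \<open>G y\<close>, which has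
  integral \<open>1 / \<mu>\<close>, so integration over \<open>y\<close> is harmless and yields
  \<open>\<bar>\<mu> * H x - G x\<bar> \<le> s\<close>, where \<open>H x = E (\<zeta> - x)\<^sup>+\<close> is the integral of the tail beyond \<open>x\<close>.

  Since \<open>-G\<close> is the derivative of \<open>H\<close>, this is an approximate differential equation
  \<open>H' = -\<mu> H\<close> with \<open>\<mu> * H 0 = 1\<close>, and a Gronwall argument gives
  \<open>\<bar>\<mu> * H x - exp (-\<mu> x)\<bar> \<le> s\<close>, so \<open>\<bar>G x - exp (-\<mu> x)\<bar> \<le> 2 s\<close>
  (lemma \<open>tail_near_exponential\<close>). Only difference inequalities are used, as \<open>H\<close> need not be
  differentiable where \<open>G\<close> jumps.

  The residual law of the mixture is a mixture of the residual laws of \<open>\<zeta>\<close> and of the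
  exponential law. Two errors arise: that of the residual law of \<open>\<zeta>\<close>, at most \<open>s\<close>, and that of
  the weights, which at age \<open>y\<close> are no longer \<open>1 / 2\<close> but proportional to \<open>G y\<close> and
  \<open>exp (-\<mu> y)\<close>. A wrong weight is paid for by the distance \<open>2 s\<close> between the two components.
  Together they cost at most \<open>2 s < 2 \<epsilon>\<close> (lemma \<open>mixture_residual_bound\<close>).
\<close>

section \<open>A Gronwall inequality without derivatives\<close>

text \<open>
  Iterating the hypothesis over \<open>n\<close> equal steps gives the factor \<open>(1 + c * T / n) ^ n\<close>, which
  tends to \<open>exp (c * T)\<close>. The sign of \<open>c\<close> is free, so that a bound backwards in time is an
  instance too.
\<close>

lemma exp_growth_lower_bound:
  fixes w :: "real \<Rightarrow> real"
  assumes T: "0 \<le> T"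
    and step: "\<And>a b. 0 \<le> a \<Longrightarrow> a \<le> b \<Longrightarrow> b \<le> T \<Longrightarrow> w a * (1 + c * (b - a)) \<le> w b"
  shows "w 0 * exp (c * T) \<le> w T"
proof -
  have bound: "w 0 * (1 + c * T / real n) ^ n \<le> w T" if n: "n > 0" "real n \<ge> \<bar>c * T\<bar>" for n
  proof -
    let ?q = "1 + c * T / real n"
    have q: "?q \<ge> 0"
      using n by (simp add: field_simps abs_le_iff)
    have "w 0 * ?q ^ k \<le> w (real k * T / real n)" if "k \<le> n" for k
      using that
    proof (induction k)
      case 0
      show ?case by simp
    next
      case (Suc k)
      have diff: "real (Suc k) * T / real n - real k * T / real n = T / real n"
        by (simp add: algebra_simps add_divide_distrib)
      have "real (Suc k) * T \<le> real n * T"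
        using Suc.prems T by (intro mult_right_mono) auto
      then have le: "real (Suc k) * T / real n \<le> T"
        using n by (simp add: field_simps)
      have "w 0 * ?q ^ Suc k = (w 0 * ?q ^ k) * ?q"
        by simp
      also have "\<dots> \<le> w (real k * T / real n) * ?q"
        using Suc q by (intro mult_right_mono) auto
      also have "\<dots> \<le> w (real (Suc k) * T / real n)"
        using step[of "real k * T / real n" "real (Suc k) * T / real n"] T le
        unfolding diff by (simp add: divide_right_mono mult_right_mono)
      finally show ?case .
    qed
    from this[of n] show ?thesis
      using n by simp
  qed
  have "(\<lambda>n. w 0 * (1 + c * T / real n) ^ n) \<longlonglongrightarrow> w 0 * exp (c * T)"
    by (intro tendsto_intros tendsto_exp_limit_sequentially)
  moreover have "\<forall>\<^sub>F n in sequentially. w 0 * (1 + c * T / real n) ^ n \<le> w T"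
    using eventually_ge_at_top[of "nat \<lceil>\<bar>c * T\<bar>\<rceil>"] eventually_gt_at_top[of 0]
  proof eventually_elim
    case (elim n)
    then show ?case
      using bound[of n] by linarith
  qed
  ultimately show ?thesis
    by (intro tendsto_upperbound) auto
qed

section \<open>Tails and mean excess\<close>

context prob_space
begin

text \<open>
  Both sides are the product measure of the region \<open>{(\<omega>, y). 0 \<le> y < Z \<omega>}\<close>.
\<close>

lemma has_integral_tail:
  assumes Z: "integrable M Z"
  shows "has_bochner_integral lborel (\<lambda>y. indicator {0..} y * \<P>(\<omega> in M. Z \<omega> > y))
           (expectation (\<lambda>\<omega>. max 0 (Z \<omega>)))"
proof -
  interpret L: pair_sigma_finite M lborel ..
  have [measurable]: "Z \<in> borel_measurable M"
    using Z by (rule borel_measurable_integrable)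
  let ?f = "\<lambda>\<omega> y :: real. indicator {0..<Z \<omega>} y :: ennreal"
  have meas: "case_prod ?f \<in> borel_measurable (M \<Otimes>\<^sub>M lborel)"
    unfolding indicator_def atLeastLessThan_iff by measurable
  have y: "(\<integral>\<^sup>+\<omega>. ?f \<omega> y \<partial>M) = ennreal (indicator {0..} y * \<P>(\<omega> in M. Z \<omega> > y))" for y
  proof -
    have "(\<integral>\<^sup>+\<omega>. ?f \<omega> y \<partial>M)
        = (\<integral>\<^sup>+\<omega>. indicator {0..} y * indicator {\<omega> \<in> space M. Z \<omega> > y} \<omega> \<partial>M)"
      by (intro nn_integral_cong) (auto simp: indicator_def)
    also have "\<dots> = indicator {0..} y * emeasure M {\<omega> \<in> space M. Z \<omega> > y}"
      by (simp add: nn_integral_cmult)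
    finally show ?thesis
      by (simp add: emeasure_eq_measure indicator_def)
  qed
  have w: "(\<integral>\<^sup>+y. ?f \<omega> y \<partial>lborel) = ennreal (max 0 (Z \<omega>))" for \<omega>
    by (cases "0 \<le> Z \<omega>") (auto simp: max_def)
  have int: "integrable M (\<lambda>\<omega>. max 0 (Z \<omega>))"
    using Z by auto
  have "(\<integral>\<^sup>+y. ennreal (indicator {0..} y * \<P>(\<omega> in M. Z \<omega> > y)) \<partial>lborel)
      = (\<integral>\<^sup>+\<omega>. ennreal (max 0 (Z \<omega>)) \<partial>M)"
    using L.Fubini'[OF meas] unfolding y w .
  also have "\<dots> = ennreal (expectation (\<lambda>\<omega>. max 0 (Z \<omega>)))"
    using int by (intro nn_integral_eq_integral) auto
  finally have nn: "(\<integral>\<^sup>+y. ennreal (indicator {0..} y * \<P>(\<omega> in M. Z \<omega> > y)) \<partial>lborel)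
      = ennreal (expectation (\<lambda>\<omega>. max 0 (Z \<omega>)))" .
  show ?thesis
  proof (rule has_bochner_integral_nn_integral[OF _ _ _ nn])
    show "(\<lambda>y. indicator {0..} y * \<P>(\<omega> in M. Z \<omega> > y)) \<in> borel_measurable lborel"
      by measurable
  qed (auto intro!: integral_nonneg)
qed

text \<open>
  This replaces the statement that the mean excess \<open>E (Z - a)\<^sup>+\<close> has derivative
  \<open>- P (Z > a)\<close> in \<open>a\<close>.
\<close>

lemma mean_excess_decrement:
  assumes Z: "integrable M Z" and "a \<le> b"
  defines "H \<equiv> \<lambda>x. expectation (\<lambda>\<omega>. max 0 (Z \<omega> - x))"
  shows "(b - a) * \<P>(\<omega> in M. Z \<omega> > b) \<le> H a - H b"
    and "H a - H b \<le> (b - a) * \<P>(\<omega> in M. Z \<omega> > a)"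
proof -
  have [measurable]: "Z \<in> borel_measurable M"
    using Z by (rule borel_measurable_integrable)
  have int: "integrable M (\<lambda>\<omega>. max 0 (Z \<omega> - x))" for x
    using Z by auto
  have ind: "expectation (\<lambda>\<omega>. (b - a) * indicator {\<omega> \<in> space M. Z \<omega> > x} \<omega>)
      = (b - a) * \<P>(\<omega> in M. Z \<omega> > x)" for x
    by simp
  have indi: "integrable M (\<lambda>\<omega>. (b - a) * indicator {\<omega> \<in> space M. Z \<omega> > x} \<omega>)" for x
    by (intro integrable_mult_right integrable_real_indicator) (auto simp: emeasure_eq_measure)
  have H: "H a - H b = expectation (\<lambda>\<omega>. max 0 (Z \<omega> - a) - max 0 (Z \<omega> - b))"
    unfolding H_def by (simp add: int Bochner_Integration.integral_diff)
  show "(b - a) * \<P>(\<omega> in M. Z \<omega> > b) \<le> H a - H b"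
    unfolding H ind[symmetric] using \<open>a \<le> b\<close> int indi
    by (intro integral_mono Bochner_Integration.integrable_diff) (auto simp: indicator_def)
  show "H a - H b \<le> (b - a) * \<P>(\<omega> in M. Z \<omega> > a)"
    unfolding H ind[symmetric] using \<open>a \<le> b\<close> int indi
    by (intro integral_mono Bochner_Integration.integrable_diff) (auto simp: indicator_def)
qed

section \<open>Almost memoryless laws are almost exponential\<close>

text \<open>
  The almost-multiplicativity of the tail, integrated over \<open>y\<close>: the tail of \<open>Z - x\<close> at \<open>y\<close> is
  the tail of \<open>Z\<close> at \<open>x + y\<close>.
\<close>

lemma mean_excess_near_tail:
  assumes Z: "integrable M Z"
  defines "G \<equiv> \<lambda>x. \<P>(\<omega> in M. Z \<omega> > x)"
  assumes near: "\<And>y. 0 \<le> y \<Longrightarrow> \<bar>G (x + y) - G x * G y\<bar> \<le> s * G y"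
  shows "\<bar>expectation (\<lambda>\<omega>. max 0 (Z \<omega> - x)) - G x * expectation (\<lambda>\<omega>. max 0 (Z \<omega>))\<bar>
           \<le> s * expectation (\<lambda>\<omega>. max 0 (Z \<omega>))"
proof -
  let ?I = "\<lambda>y :: real. indicator {0..} y :: real"
  have t: "has_bochner_integral lborel (\<lambda>y. ?I y * G y) (expectation (\<lambda>\<omega>. max 0 (Z \<omega>)))"
    unfolding G_def by (rule has_integral_tail[OF Z])
  have "has_bochner_integral lborel (\<lambda>y. ?I y * \<P>(\<omega> in M. Z \<omega> - x > y))
      (expectation (\<lambda>\<omega>. max 0 (Z \<omega> - x)))"
    using Z by (intro has_integral_tail) auto
  moreover have "(\<lambda>y. \<P>(\<omega> in M. Z \<omega> - x > y)) = (\<lambda>y. G (x + y))"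
    unfolding G_def by (auto simp: algebra_simps)
  ultimately have t': "has_bochner_integral lborel (\<lambda>y. ?I y * G (x + y))
      (expectation (\<lambda>\<omega>. max 0 (Z \<omega> - x)))"
    by metis
  have d: "has_bochner_integral lborel (\<lambda>y. ?I y * G (x + y) - G x * (?I y * G y))
      (expectation (\<lambda>\<omega>. max 0 (Z \<omega> - x)) - G x * expectation (\<lambda>\<omega>. max 0 (Z \<omega>)))"
    by (intro has_bochner_integral_diff has_bochner_integral_mult_right t t')
  have e: "has_bochner_integral lborel (\<lambda>y. s * (?I y * G y))
      (s * expectation (\<lambda>\<omega>. max 0 (Z \<omega>)))"
    by (intro has_bochner_integral_mult_right t)
  have "norm (integral\<^sup>L lborel (\<lambda>y. ?I y * G (x + y) - G x * (?I y * G y)))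
      \<le> integral\<^sup>L lborel (\<lambda>y. s * (?I y * G y))"
  proof (rule Bochner_Integration.integral_norm_bound_integral)
    show "norm (?I y * G (x + y) - G x * (?I y * G y)) \<le> s * (?I y * G y)" for y
      using near[of y] by (auto simp: indicator_def)
  qed (use d e in \<open>auto simp: has_bochner_integral_iff\<close>)
  then show ?thesis
    unfolding has_bochner_integral_integral_eq[OF d] has_bochner_integral_integral_eq[OF e]
    by simp
qed

text \<open>
  With \<open>H\<close> the mean excess, the decrement inequalities and \<open>\<bar>\<mu> * H x - G x\<bar> \<le> s\<close> give, for
  \<open>a \<le> b\<close>, that \<open>\<mu> * H + s\<close> loses at most the fraction \<open>\<mu> * (b - a)\<close> of its value at \<open>a\<close>, and
  that \<open>\<mu> * H - s\<close> loses at least that fraction of its value at \<open>b\<close>. The second is a growth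
  bound for reversed time.
\<close>

lemma tail_near_exponential:
  assumes Z: "integrable M Z" and mu: "\<mu> > 0"
    and mean: "expectation (\<lambda>\<omega>. max 0 (Z \<omega>)) = 1 / \<mu>"
  defines "G \<equiv> \<lambda>x. \<P>(\<omega> in M. Z \<omega> > x)"
  assumes near: "\<And>x y. 0 \<le> x \<Longrightarrow> 0 \<le> y \<Longrightarrow> \<bar>G (x + y) - G x * G y\<bar> \<le> s * G y"
    and s: "0 \<le> s" and x: "0 \<le> x"
  shows "\<bar>G x - exp (- \<mu> * x)\<bar> \<le> 2 * s"
proof -
  define H where "H = (\<lambda>x. expectation (\<lambda>\<omega>. max 0 (Z \<omega> - x)))"
  have H0: "\<mu> * H 0 = 1"
    using mean mu by (simp add: H_def)
  have HG: "\<bar>\<mu> * H a - G a\<bar> \<le> s" if "0 \<le> a" for a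
  proof -
    have "\<bar>H a - G a * (1 / \<mu>)\<bar> \<le> s * (1 / \<mu>)"
      using mean_excess_near_tail[OF Z, of a s] near[OF that] unfolding H_def G_def mean by simp
    then have "\<mu> * \<bar>H a - G a * (1 / \<mu>)\<bar> \<le> \<mu> * (s * (1 / \<mu>))"
      using mu by (intro mult_left_mono) auto
    moreover have "\<mu> * \<bar>H a - G a * (1 / \<mu>)\<bar> = \<bar>\<mu> * (H a - G a * (1 / \<mu>))\<bar>"
      using mu by (simp add: abs_mult)
    ultimately show ?thesis
      using mu by (simp add: algebra_simps)
  qed
  have dec: "(b - a) * G b \<le> H a - H b" "H a - H b \<le> (b - a) * G a" if "a \<le> b" for a b
    using mean_excess_decrement[OF Z that] unfolding H_def G_def by auto
  have up: "\<mu> * (H a - H b) \<le> \<mu> * (b - a) * (\<mu> * H a + s)" if "0 \<le> a" "a \<le> b" for a b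
  proof -
    have "H a - H b \<le> (b - a) * (\<mu> * H a + s)"
      using dec(2)[OF that(2)] HG[OF that(1)] that
      by (intro order_trans[OF dec(2)[OF that(2)]] mult_left_mono) auto
    then show ?thesis
      using mult_left_mono[of _ _ \<mu>] mu by (simp add: mult.assoc)
  qed
  have lo: "\<mu> * (b - a) * (\<mu> * H b - s) \<le> \<mu> * (H a - H b)" if "0 \<le> a" "a \<le> b" for a b
  proof -
    have "(b - a) * (\<mu> * H b - s) \<le> H a - H b"
      using HG[of b] that
      by (intro order_trans[OF _ dec(1)[OF that(2)]] mult_left_mono) auto
    then show ?thesis
      using mult_left_mono[of _ _ \<mu>] mu by (simp add: mult.assoc)
  qed
  have "(\<mu> * H 0 + s) * exp (- \<mu> * x) \<le> \<mu> * H x + s"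
  proof (rule exp_growth_lower_bound[OF x])
    fix a b :: real
    assume "0 \<le> a" "a \<le> b"
    from up[OF this] show "(\<mu> * H a + s) * (1 + - \<mu> * (b - a)) \<le> \<mu> * H b + s"
      by (simp add: algebra_simps)
  qed
  moreover have "(\<mu> * H (x - 0) - s) * exp (\<mu> * x) \<le> \<mu> * H (x - x) - s"
  proof (rule exp_growth_lower_bound[OF x, where w = "\<lambda>t. \<mu> * H (x - t) - s"])
    fix a b :: real
    assume "a \<le> b" "b \<le> x"
    then show "(\<mu> * H (x - a) - s) * (1 + \<mu> * (b - a)) \<le> \<mu> * H (x - b) - s"
      using lo[of "x - b" "x - a"] by (simp add: algebra_simps)
  qed
  then have "\<mu> * H x - s \<le> (\<mu> * H 0 - s) * exp (- \<mu> * x)"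
    by (simp add: exp_minus field_simps)
  ultimately have "\<bar>\<mu> * H x - exp (- \<mu> * x)\<bar> \<le> s - s * exp (- \<mu> * x)"
    unfolding H0 by (simp add: algebra_simps abs_le_iff)
  also have "\<dots> \<le> s"
    using s by simp
  finally show ?thesis
    using HG[OF x] by linarith
qed

section \<open>Residual laws\<close>

lemma cdf_distr_eq_tail:
  assumes [measurable]: "Z \<in> borel_measurable M"
  shows "cdf (distr M borel Z) x = 1 - \<P>(\<omega> in M. Z \<omega> > x)"
proof -
  have "cdf (distr M borel Z) x = \<P>(\<omega> in M. \<not> Z \<omega> > x)"
    by (auto simp: cdf_def2 measure_distr not_less intro!: arg_cong[where f = prob])
  then show ?thesis
    by (simp add: prob_neg)
qed

lemma residual_cdf_eq_tail:
  assumes [measurable]: "Z \<in> borel_measurable M" and "0 \<le> x"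
  defines "G \<equiv> \<lambda>x. \<P>(\<omega> in M. Z \<omega> > x)"
  shows "residual_cdf M Z y x = (G y - G (x + y)) / G y"
proof -
  have "{\<omega> \<in> space M. Z \<omega> \<le> x + y \<and> y < Z \<omega>}
      = {\<omega> \<in> space M. Z \<omega> > y} - {\<omega> \<in> space M. Z \<omega> > x + y}"
    by auto
  moreover have "prob ({\<omega> \<in> space M. Z \<omega> > y} - {\<omega> \<in> space M. Z \<omega> > x + y}) = G y - G (x + y)"
    unfolding G_def using \<open>0 \<le> x\<close> by (intro finite_measure_Diff) auto
  ultimately show ?thesis
    by (simp add: residual_cdf_def cond_prob_def G_def)
qed

text \<open>
  A supremum of reals is an upper bound only when the set is bounded; here every deviation is a
  difference of two probabilities.
\<close>

lemma residual_deviation_le_sup: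
  assumes [measurable]: "Z \<in> borel_measurable M"
    and F: "F = cdf (distr M borel Z)"
    and xy: "0 \<le> x" "0 \<le> y" "\<P>(\<omega> in M. Z \<omega> > y) > 0"
  shows "\<bar>residual_cdf M Z y x - F x\<bar>
    \<le> (SUP (x, y) \<in> {(x, y). x \<ge> 0 \<and> y \<ge> 0 \<and> \<P>(\<omega> in M. Z \<omega> > y) > 0}.
          \<bar>residual_cdf M Z y x - F x\<bar>)" (is "_ \<le> (SUP p \<in> ?S. ?f p)")
proof -
  have "bdd_above (?f ` ?S)"
  proof (rule bdd_aboveI2)
    fix p
    assume "p \<in> ?S"
    then obtain a b where p: "p = (a, b)" "0 \<le> a" "\<P>(\<omega> in M. Z \<omega> > b) > 0"
      by auto
    have "\<P>(\<omega> in M. Z \<omega> > a + b) \<le> \<P>(\<omega> in M. Z \<omega> > b)"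
      using p by (intro finite_measure_mono) auto
    then have "0 \<le> residual_cdf M Z b a" "residual_cdf M Z b a \<le> 1"
      using p by (simp_all add: residual_cdf_eq_tail)
    moreover have "0 \<le> F a" "F a \<le> 1"
      by (simp_all add: F cdf_distr_eq_tail)
    ultimately show "?f p \<le> 1"
      by (simp add: p abs_le_iff)
  qed
  then have "?f (x, y) \<le> (SUP p \<in> ?S. ?f p)"
    using xy by (intro cSUP_upper) auto
  then show ?thesis
    by simp
qed

end

text \<open>
  Here \<open>a\<close>, \<open>c\<close>, \<open>g\<close> are the tail of one component at \<open>x\<close>, \<open>x + y\<close>, \<open>y\<close>, while \<open>b\<close>, \<open>b * e\<close>, \<open>e\<close>
  are those of an exponential one. After clearing the denominator, the difference is
  \<open>(c - a * g) + (a - b) * (g - e) / 2\<close>: the error of the residual law and that of the weights.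
\<close>

lemma mixture_residual_bound:
  fixes a b c e g s :: real
  assumes "0 \<le> g" "0 < e" "0 \<le> s"
    and c: "\<bar>c - a * g\<bar> \<le> s * g" and ab: "\<bar>a - b\<bar> \<le> 2 * s"
  shows "\<bar>(c + b * e) / (g + e) - (a + b) / 2\<bar> \<le> 2 * s"
proof -
  have pos: "g + e > 0"
    using assms by simp
  have "(c + b * e) / (g + e) - (a + b) / 2 = ((c - a * g) + (a - b) * (g - e) / 2) / (g + e)"
    using pos by (simp add: field_simps)
  moreover have "\<bar>(c - a * g) + (a - b) * (g - e) / 2\<bar> \<le> s * g + s * (g + e)"
  proof -
    have "\<bar>(a - b) * (g - e)\<bar> \<le> 2 * s * (g + e)"
      unfolding abs_mult using assms by (intro mult_mono) auto
    then show ?thesis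
      using c by linarith
  qed
  moreover have "s * g + s * (g + e) \<le> 2 * s * (g + e)"
    using assms by (simp add: algebra_simps)
  ultimately show ?thesis
    using pos by (simp add: abs_divide pos_divide_le_eq)
qed

section \<open>The mixture\<close>

theorem mainTheorem7:
  fixes M :: "'a measure" and N :: "'b measure"
    and \<zeta> :: "'a \<Rightarrow> real" and X :: "'b \<Rightarrow> real"
    and F B :: "real \<Rightarrow> real" and \<mu> \<epsilon> :: real
  assumes "\<mu> > 0" and "\<epsilon> > 0"
    and "prob_space M" and "\<zeta> \<in> borel_measurable M"
    and "AE \<omega> in M. \<zeta> \<omega> \<ge> 0"
    and "integrable M \<zeta>" and "(\<integral>\<omega>. \<zeta> \<omega> \<partial>M) = 1 / \<mu>"
    and "F = cdf (distr M borel \<zeta>)"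
    and "(SUP (x, y) \<in> {(x, y). x \<ge> 0 \<and> y \<ge> 0 \<and> \<P>(\<omega> in M. \<zeta> \<omega> > y) > 0}.
            \<bar>residual_cdf M \<zeta> y x - F x\<bar>) < \<epsilon>"
    and "prob_space N" and "X \<in> borel_measurable N"
    and "B = cdf (distr N borel X)"
    and "\<And>x. x \<ge> 0 \<Longrightarrow> B x = 1 / 2 * F x + 1 / 2 * (1 - exp (- \<mu> * x))"
    and "B 0 = 0"
  shows "(SUP (x, y) \<in> {(x, y). x \<ge> 0 \<and> y \<ge> 0}. \<bar>residual_cdf N X y x - B x\<bar>) < 2 * \<epsilon>"
proof -
  interpret M: prob_space M by fact
  interpret N: prob_space N by fact
  note [measurable] = assms(4, 11)
  define G where "G = (\<lambda>x. \<P>(\<omega> in M. \<zeta> \<omega> > x))"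
  define K where "K = (\<lambda>x. \<P>(\<omega> in N. X \<omega> > x))"
  define s where "s = (SUP (x, y) \<in> {(x, y). x \<ge> 0 \<and> y \<ge> 0 \<and> \<P>(\<omega> in M. \<zeta> \<omega> > y) > 0}.
            \<bar>residual_cdf M \<zeta> y x - F x\<bar>)"
  have F: "F x = 1 - G x" for x
    by (simp add: assms(8) M.cdf_distr_eq_tail G_def)
  have B: "B x = 1 - K x" for x
    by (simp add: assms(12) N.cdf_distr_eq_tail K_def)
  have K: "K x = (G x + exp (- \<mu> * x)) / 2" if "0 \<le> x" for x
    using assms(13)[OF that] by (simp add: F B field_simps)
  have le_s: "\<bar>residual_cdf M \<zeta> y x - F x\<bar> \<le> s" if "0 \<le> x" "0 \<le> y" "G y > 0" for x y
    unfolding s_def using M.residual_deviation_le_sup[OF assms(4, 8)] that by (simp add: G_def)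
  have "G 0 = 1"
    using \<open>B 0 = 0\<close> K[of 0] by (simp add: B)
  then have s0: "0 \<le> s"
    using le_s[of 0 0] by simp
  have near: "\<bar>G (x + y) - G x * G y\<bar> \<le> s * G y" if xy: "0 \<le> x" "0 \<le> y" for x y
  proof (cases "G y = 0")
    case True
    have "0 \<le> G (x + y)" "G (x + y) \<le> G y"
      unfolding G_def using xy by (auto intro!: M.finite_measure_mono)
    with True show ?thesis
      by simp
  next
    case False
    then have pos: "G y > 0"
      by (simp add: G_def zero_less_measure_iff)
    have "\<bar>G (x + y) - G x * G y\<bar> = \<bar>residual_cdf M \<zeta> y x - F x\<bar> * G y"
    proof -
      have "(residual_cdf M \<zeta> y x - F x) * G y = G x * G y - G (x + y)"
        using pos M.residual_cdf_eq_tail[OF assms(4) xy(1), of y]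
        by (simp add: F G_def field_simps)
      then show ?thesis
        using pos by (metis abs_minus_commute abs_mult abs_of_pos)
    qed
    also have "\<dots> \<le> s * G y"
      using le_s[OF xy pos] pos by (intro mult_right_mono) auto
    finally show ?thesis .
  qed
  have "M.expectation (\<lambda>\<omega>. max 0 (\<zeta> \<omega>)) = M.expectation \<zeta>"
    using assms(5) by (intro integral_cong_AE) auto
  then have exp_near: "\<bar>G x - exp (- \<mu> * x)\<bar> \<le> 2 * s" if "0 \<le> x" for x
    using M.tail_near_exponential[OF assms(6) \<open>\<mu> > 0\<close> _ _ s0 that] near assms(7)
    by (simp add: G_def)
  have "\<bar>residual_cdf N X y x - B x\<bar> \<le> 2 * s" if xy: "0 \<le> x" "0 \<le> y" for x y
  proof -
    have g0: "0 \<le> G y"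
      by (simp add: G_def)
    have Ky: "K y > 0"
      using add_nonneg_pos[OF g0 exp_gt_zero[of "- \<mu> * y"]] K[OF xy(2)] by simp
    have "residual_cdf N X y x = 1 - K (x + y) / K y"
      using N.residual_cdf_eq_tail[OF assms(11) xy(1), of y] Ky
      by (simp add: K_def diff_divide_distrib)
    also have "K (x + y) / K y
        = (G (x + y) + exp (- \<mu> * x) * exp (- \<mu> * y)) / (G y + exp (- \<mu> * y))"
    proof -
      have "- \<mu> * (x + y) = - \<mu> * x + - \<mu> * y"
        by (simp add: algebra_simps)
      then have "exp (- \<mu> * (x + y)) = exp (- \<mu> * x) * exp (- \<mu> * y)"
        by (metis exp_add)
      moreover have "a / 2 / (b / 2) = a / b" for a b :: real
        by simp
      ultimately show ?thesis
        using xy by (metis K add_nonneg_nonneg)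
    qed
    finally have "\<bar>residual_cdf N X y x - B x\<bar>
        = \<bar>(G (x + y) + exp (- \<mu> * x) * exp (- \<mu> * y)) / (G y + exp (- \<mu> * y))
            - (G x + exp (- \<mu> * x)) / 2\<bar>"
      by (simp add: B K[OF xy(1)] abs_minus_commute)
    also have "\<dots> \<le> 2 * s"
      using g0 s0 near[OF xy] exp_near[OF xy(1)] by (intro mixture_residual_bound) auto
    finally show ?thesis .
  qed
  then have "(SUP (x, y) \<in> {(x, y). x \<ge> 0 \<and> y \<ge> 0}. \<bar>residual_cdf N X y x - B x\<bar>) \<le> 2 * s"
    by (intro cSUP_least) (auto intro: exI[of _ 0])
  also have "\<dots> < 2 * \<epsilon>"
    using assms(9) by (simp add: s_def)
  finally show ?thesis .
qed

end
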